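(* Let $a<b$ and $c<d$ be real numbers, let $\Delta := [a,b]\times[c,d]\subset\mathbb{R}^2$, and let $f:\Delta\to\mathbb{R}$ be a partial differentiable mapping on $\Delta$. Let $q\ge 1$. If $\left|\dfrac{\partial^2 f}{\partial t\partial s}\right|^q$ is a convex function on the co-ordinates on $\Delta$, then $$\left|\frac{f(a,c)+f(a,d)+f(b,c)+f(b,d)}{4}+\frac{1}{(b-a)(d-c)}\int_a^b\int_c^d f(x,y)\,dy\,dx-A\right|$$ $$\le\frac{(b-a)(d-c)}{16}\left(\frac{\left|\frac{\partial^2 f}{\partial t\partial s}(a,c)\right|^q+\left|\frac{\partial^2 f}{\partial t\partial s}(a,d)\right|^q+\left|\frac{\partial^2 f}{\partial t\partial s}(b,c)\right|^q+\left|\frac{\partial^2 f}{\partial t\partial s}(b,d)\right|^q}{4}\right)^{\frac1q},$$ where $$A=\frac12\left[\frac{1}{b-a}\int_a^b\left[f(x,c)+f(x,d)\right]dx+\frac{1}{d-c}\int_c^d\left[f(a,y)+f(b,y)\right]dy\right].$$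
   Context: "Partial differentiable mapping on $\Delta$" means that the first-order partial derivatives of $f$ and the mixed second-order partial derivative $\frac{\partial^2 f}{\partial t\partial s}$ exist at every point of $\Delta$ (one-sided derivatives being used at the boundary). Here $\frac{\partial^2 f}{\partial t\partial s}$ denotes the mixed partial derivative of $f$ with respect to its own two variables ($t$ standing for the first variable and $s$ for the second): $f$ is differentiated first in the second variable, then in the first. A function $g:\Delta\to\mathbb{R}$ is convex on the co-ordinates (co-ordinated convex) on $\Delta$ if for all $t,s\in[0,1]$, all $x,y\in[a,b]$ and all $u,v\in[c,d]$, $$g(tx+(1-t)y,\,su+(1-s)v)\le ts\,g(x,u)+s(1-t)\,g(y,u)+t(1-s)\,g(x,v)+(1-t)(1-s)\,g(y,v).$$ Equivalently, the partial mappings $u\mapsto g(u,y)$ on $[a,b]$ and $v\mapsto g(x,v)$ on $[c,d]$ are convex for all $y\in[c,d]$ and $x\in[a,b]$. *)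

theory Defs
  imports "HOL-Analysis.Analysis"
begin

text \<open>
  Derivatives are taken within the closed intervals, so they are one-sided on the boundary of the
  rectangle and depend only on the values of \<open>f\<close> on the rectangle.
\<close>

definition partial1 :: "real \<Rightarrow> real \<Rightarrow> (real \<times> real \<Rightarrow> real) \<Rightarrow> real \<times> real \<Rightarrow> real" where
  "partial1 a b f = (\<lambda>(x, y). vector_derivative (\<lambda>t. f (t, y)) (at x within {a..b}))"

definition partial2 :: "real \<Rightarrow> real \<Rightarrow> (real \<times> real \<Rightarrow> real) \<Rightarrow> real \<times> real \<Rightarrow> real" where
  "partial2 c d f = (\<lambda>(x, y). vector_derivative (\<lambda>s. f (x, s)) (at y within {c..d}))"

definition mixed_partial ::
    "real \<Rightarrow> real \<Rightarrow> real \<Rightarrow> real \<Rightarrow> (real \<times> real \<Rightarrow> real) \<Rightarrow> real \<times> real \<Rightarrow> real" where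
  "mixed_partial a b c d f = partial1 a b (partial2 c d f)"

text \<open>
  Only existence is required: neither joint differentiability nor continuity of any derivative.
\<close>

definition partial_differentiable_on_rect ::
    "real \<Rightarrow> real \<Rightarrow> real \<Rightarrow> real \<Rightarrow> (real \<times> real \<Rightarrow> real) \<Rightarrow> bool" where
  "partial_differentiable_on_rect a b c d f \<longleftrightarrow>
    (\<forall>x\<in>{a..b}. \<forall>y\<in>{c..d}.
      (\<lambda>t. f (t, y)) differentiable (at x within {a..b}) \<and>
      (\<lambda>s. f (x, s)) differentiable (at y within {c..d}) \<and>
      (\<lambda>t. partial2 c d f (t, y)) differentiable (at x within {a..b}))"

definition coordinated_convex_on_rect ::
    "real \<Rightarrow> real \<Rightarrow> real \<Rightarrow> real \<Rightarrow> (real \<times> real \<Rightarrow> real) \<Rightarrow> bool" where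
  "coordinated_convex_on_rect a b c d g \<longleftrightarrow>
    (\<forall>t\<in>{0..1}. \<forall>s\<in>{0..1}. \<forall>x\<in>{a..b}. \<forall>y\<in>{a..b}. \<forall>u\<in>{c..d}. \<forall>v\<in>{c..d}.
      g (t * x + (1 - t) * y, s * u + (1 - s) * v)
        \<le> t * s * g (x, u) + s * (1 - t) * g (y, u)
          + t * (1 - s) * g (x, v) + (1 - t) * (1 - s) * g (y, v))"

end

theory Submission
  imports Defs
begin

text \<open>
  Put \<open>S\<close> for the mean of the four corner values of \<open>\<bar>f\<^sub>t\<^sub>s\<bar> powr q\<close>.  Young's inequality linearises the
  \<open>q\<close>-th root at \<open>S\<close>, so that \<open>\<bar>f\<^sub>t\<^sub>s\<bar>\<close> lies below a bilinear function \<open>\<psi>\<close> whose value at the centre of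
  the rectangle is \<open>S powr (1 / q)\<close>.  The increments of \<open>f\<close> over subrectangles are then dominated by
  those of a polynomial \<open>P\<close> with \<open>P\<^sub>t\<^sub>s = \<psi>\<close>; no integrability of \<open>f\<^sub>t\<^sub>s\<close> is needed.  The left-hand side
  is, up to scaling, the trapezoid error functional applied in both variables.  Folding each variable
  about its midpoint expresses it by the increments over four corner rectangles in symmetric position,
  and in the sum of the increments of \<open>P\<close> over these only the central value of \<open>\<psi>\<close> survives.
\<close>

section \<open>Increments over rectangles and their domination\<close>

text \<open>For smooth \<open>f\<close> this is the integral of the mixed derivative over the
  rectangle; it stands in for that integral, which need not exist here.\<close>

definition rect_increment :: "(real \<times> real \<Rightarrow> real) \<Rightarrow> real \<Rightarrow> real \<Rightarrow> real \<Rightarrow> real \<Rightarrow> real" where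
  "rect_increment f x x' y y' = f (x', y') - f (x, y') - f (x', y) + f (x, y)"

lemma partial2_has_vector_derivative:
  assumes "partial_differentiable_on_rect a b c d f" "x \<in> {a..b}" "y \<in> {c..d}"
  shows "((\<lambda>s. f (x, s)) has_vector_derivative partial2 c d f (x, y)) (at y within {c..d})"
  using assms unfolding partial_differentiable_on_rect_def partial2_def
  by (simp add: vector_derivative_works)

lemma mixed_partial_has_vector_derivative:
  assumes "partial_differentiable_on_rect a b c d f" "x \<in> {a..b}" "y \<in> {c..d}"
  shows "((\<lambda>t. partial2 c d f (t, y)) has_vector_derivative mixed_partial a b c d f (x, y))
    (at x within {a..b})"
  using assms unfolding partial_differentiable_on_rect_def mixed_partial_def partial1_def
  by (simp add: vector_derivative_works)

text \<open>The mean value inequality in comparison form: \<open>h'\<close> is never integrated, so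
  it may be an arbitrary function. \<open>T\<close> will be a full side of the rectangle, within
  which the derivatives of \<open>f\<close> are taken; they restrict to
  \<open>{l..u}\<close>.\<close>

lemma has_vector_derivative_abs_increment_le:
  fixes h p :: "real \<Rightarrow> real"
  assumes "l \<le> u" "{l..u} \<subseteq> T"
    and h: "\<And>x. x \<in> {l..u} \<Longrightarrow> (h has_vector_derivative h' x) (at x within T)"
    and p: "\<And>x. x \<in> {l..u} \<Longrightarrow> (p has_vector_derivative p' x) (at x within T)"
    and le: "\<And>x. x \<in> {l..u} \<Longrightarrow> \<bar>h' x\<bar> \<le> p' x"
  shows "\<bar>h u - h l\<bar> \<le> p u - p l"
proof (cases "l = u")
  case False
  have h2: "(h has_vector_derivative h' x) (at x within {l..u})" if "x \<in> {l..u}" for x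
    using has_vector_derivative_within_subset[OF h[OF that] assms(2)] .
  have p2: "(p has_vector_derivative p' x) (at x within {l..u})" if "x \<in> {l..u}" for x
    using has_vector_derivative_within_subset[OF p[OF that] assms(2)] .
  have "norm (h u - h l) \<le> p u - p l"
  proof (rule differentiable_bound_general)
    show "l < u" using False assms(1) by simp
    show "continuous_on {l..u} h" "continuous_on {l..u} p"
      by (rule continuous_on_vector_derivative[OF h2] continuous_on_vector_derivative[OF p2]; assumption)+
    show "(h has_vector_derivative h' x) (at x)" if "l < x" "x < u" for x
      using h2[of x] that at_within_Icc_at[of l x u] by simp
    show "(p has_vector_derivative p' x) (at x)" if "l < x" "x < u" for x
      using p2[of x] that at_within_Icc_at[of l x u] by simp
    show "norm (h' x) \<le> p' x" if "l < x" "x < u" for x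
      using le[of x] that by simp
  qed
  then show ?thesis by simp
qed simp

text \<open>The one-variable comparison is applied twice, undoing the differentiations in reverse
  order: first in the first variable to \<open>partial2\<close> at a fixed second coordinate, then
  in the second variable to the difference of two sections of \<open>f\<close>, whose derivative has
  just been bounded.\<close>

lemma rect_increment_le:
  fixes P Q \<psi> :: "real \<times> real \<Rightarrow> real"
  assumes f: "partial_differentiable_on_rect a b c d f"
    and P: "\<And>x y. ((\<lambda>s. P (x, s)) has_vector_derivative Q (x, y)) (at y within {c..d})"
    and Q: "\<And>x y. ((\<lambda>t. Q (t, y)) has_vector_derivative \<psi> (x, y)) (at x within {a..b})"
    and le: "\<And>x y. x \<in> {a..b} \<Longrightarrow> y \<in> {c..d} \<Longrightarrow> \<bar>mixed_partial a b c d f (x, y)\<bar> \<le> \<psi> (x, y)"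
    and x: "a \<le> x" "x \<le> x'" "x' \<le> b" and y: "c \<le> y" "y \<le> y'" "y' \<le> d"
  shows "\<bar>rect_increment f x x' y y'\<bar> \<le> rect_increment P x x' y y'"
proof -
  have 1: "\<bar>partial2 c d f (x', s) - partial2 c d f (x, s)\<bar> \<le> Q (x', s) - Q (x, s)"
    if s: "s \<in> {c..d}" for s
    by (rule has_vector_derivative_abs_increment_le[where T = "{a..b}",
          OF _ _ mixed_partial_has_vector_derivative[OF f _ s] Q le[OF _ s]])
      (use x in auto)
  have "\<bar>(f (x', y') - f (x, y')) - (f (x', y) - f (x, y))\<bar>
      \<le> (P (x', y') - P (x, y')) - (P (x', y) - P (x, y))"
    by (rule has_vector_derivative_abs_increment_le[where T = "{c..d}",
          OF _ _ has_vector_derivative_diff has_vector_derivative_diff[OF P P] 1])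
      (use x y in \<open>auto intro: partial2_has_vector_derivative[OF f]\<close>)
  then show ?thesis by (simp add: rect_increment_def algebra_simps)
qed

section \<open>Joint continuity\<close>

text \<open>The partial derivatives give only separate continuity. A bounded mixed derivative adds
  that increments are at most \<open>M\<close> times the area of the rectangle, and \<open>f\<close>
  is a sum of two sections, a constant and such an increment.\<close>

lemma continuous_on_rect:
  assumes f: "partial_differentiable_on_rect a b c d f"
    and le: "\<And>x y. x \<in> {a..b} \<Longrightarrow> y \<in> {c..d} \<Longrightarrow> \<bar>mixed_partial a b c d f (x, y)\<bar> \<le> M"
  shows "continuous_on ({a..b} \<times> {c..d}) f"
proof -
  define P :: "real \<times> real \<Rightarrow> real" where "P = (\<lambda>(x, y). M * x * y)"
  have ordered: "\<bar>rect_increment f x x' y y'\<bar> \<le> M * \<bar>x' - x\<bar> * \<bar>y' - y\<bar>"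
    if "a \<le> x" "x \<le> x'" "x' \<le> b" "c \<le> y" "y \<le> y'" "y' \<le> d" for x x' y y'
  proof -
    have "\<bar>rect_increment f x x' y y'\<bar> \<le> rect_increment P x x' y y'"
      by (rule rect_increment_le[where Q = "\<lambda>(x, y). M * x" and \<psi> = "\<lambda>_. M", OF f _ _ _ that])
        (auto simp: P_def le has_real_derivative_iff_has_vector_derivative[symmetric]
          intro!: derivative_eq_intros)
    then show ?thesis using that by (simp add: P_def rect_increment_def algebra_simps)
  qed
  \<comment> \<open>Exchanging two endpoints only changes the sign, so the area bound extends to
    points on any side of the base point.\<close>
  have swap: "\<bar>rect_increment f x' x y y'\<bar> = \<bar>rect_increment f x x' y y'\<bar>"
    "\<bar>rect_increment f x x' y' y\<bar> = \<bar>rect_increment f x x' y y'\<bar>" for x x' y y'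
    by (auto simp: rect_increment_def)
  have inc_x: "\<bar>rect_increment f x x' y y'\<bar> \<le> M * \<bar>x' - x\<bar> * \<bar>y' - y\<bar>"
    if "a \<le> x" "x \<le> x'" "x' \<le> b" "y \<in> {c..d}" "y' \<in> {c..d}" for x x' y y'
  proof (cases "y \<le> y'")
    case True
    then show ?thesis using ordered[of x x' y y'] that by simp
  next
    case False
    then show ?thesis
      using ordered[of x x' y' y] that swap(2)[of x x' y' y] abs_minus_commute[of y y'] by simp
  qed
  have inc: "\<bar>rect_increment f x x' y y'\<bar> \<le> M * \<bar>x' - x\<bar> * \<bar>y' - y\<bar>"
    if "x \<in> {a..b}" "x' \<in> {a..b}" "y \<in> {c..d}" "y' \<in> {c..d}" for x x' y y'
  proof (cases "x \<le> x'")
    case True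
    then show ?thesis using inc_x[of x x' y y'] that by simp
  next
    case False
    then show ?thesis
      using inc_x[of x' x y y'] that swap(1)[of x x' y y'] abs_minus_commute[of x x'] by simp
  qed
  have cx: "continuous_on {a..b} (\<lambda>t. f (t, y))" if "y \<in> {c..d}" for y
    using f that unfolding partial_differentiable_on_rect_def
    by (auto simp: continuous_on_eq_continuous_within intro: differentiable_imp_continuous_within)
  have cy: "continuous_on {c..d} (\<lambda>s. f (x, s))" if "x \<in> {a..b}" for x
    using f that unfolding partial_differentiable_on_rect_def
    by (auto simp: continuous_on_eq_continuous_within intro: differentiable_imp_continuous_within)
  show ?thesis
    unfolding continuous_on_def
  proof safe
    fix x y assume xy: "x \<in> {a..b}" "y \<in> {c..d}"
    let ?F = "at (x, y) within {a..b} \<times> {c..d}"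
    have ev: "eventually (\<lambda>p. p \<in> {a..b} \<times> {c..d}) ?F"
      by (simp add: eventually_at_filter)
    have c1: "continuous_on ({a..b} \<times> {c..d}) (\<lambda>p. f (fst p, y))"
      by (rule continuous_on_compose2[OF cx[OF xy(2)]]) (auto intro: continuous_intros)
    have c2: "continuous_on ({a..b} \<times> {c..d}) (\<lambda>p. f (x, snd p))"
      by (rule continuous_on_compose2[OF cy[OF xy(1)]]) (auto intro: continuous_intros)
    have l1: "((\<lambda>p. f (fst p, y)) \<longlongrightarrow> f (x, y)) ?F" "((\<lambda>p. f (x, snd p)) \<longlongrightarrow> f (x, y)) ?F"
      using c1 c2 xy unfolding continuous_on_def by force+
    have "((\<lambda>p. M * \<bar>fst p - x\<bar> * \<bar>snd p - y\<bar>) \<longlongrightarrow> M * \<bar>fst (x, y) - x\<bar> * \<bar>snd (x, y) - y\<bar>) ?F"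
      by (intro tendsto_intros)
    then have l0: "((\<lambda>p. M * \<bar>fst p - x\<bar> * \<bar>snd p - y\<bar>) \<longlongrightarrow> 0) ?F" by simp
    have l3: "((\<lambda>p. rect_increment f x (fst p) y (snd p)) \<longlongrightarrow> 0) ?F"
      by (rule Lim_null_comparison[OF _ l0])
        (use ev xy inc in \<open>auto elim!: eventually_mono\<close>)
    \<comment> \<open>After cancellation the function in this limit is \<open>f p\<close>
      itself.\<close>
    have "((\<lambda>p. f (fst p, y) + f (x, snd p) - f (x, y) + rect_increment f x (fst p) y (snd p))
        \<longlongrightarrow> f (x, y) + f (x, y) - f (x, y) + 0) ?F"
      by (intro tendsto_intros l1 l3)
    then show "(f \<longlongrightarrow> f (x, y)) ?F" by (simp add: rect_increment_def)
  qed
qed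

section \<open>The trapezoid error in one variable\<close>

text \<open>Reflection in the midpoint moves the right half of the integral onto the left half, so
  the error is the integral of the folded defect over \<open>{a..m}\<close>. Since the hypothesis
  bounds that defect and not a derivative, the lemma can be used in one variable after the
  other.\<close>

lemma trapezoid_error_le:
  fixes h :: "real \<Rightarrow> real"
  assumes "a \<le> b" and h: "continuous_on {a..b} h"
    and le: "\<And>x. a \<le> x \<Longrightarrow> x \<le> (a + b) / 2 \<Longrightarrow> \<bar>h a + h b - h x - h (a + b - x)\<bar> \<le> K * (x - a)"
  shows "\<bar>(b - a) / 2 * (h a + h b) - integral {a..b} h\<bar> \<le> K * (b - a)\<^sup>2 / 8"
proof -
  define m where "m = (a + b) / 2"
  have m: "a \<le> m" "m \<le> b" "a + b - m = m" using assms(1) by (auto simp: m_def field_simps)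
  have hl: "h integrable_on {a..m}"
    using h m by (intro integrable_continuous_real) (auto intro: continuous_on_subset)
  have cr: "continuous_on {a..m} (\<lambda>x. h (a + b - x))"
    by (rule continuous_on_compose2[OF h]) (use m in \<open>auto intro!: continuous_intros\<close>)
  have hr: "(\<lambda>x. h (a + b - x)) integrable_on {a..m}"
    by (intro integrable_continuous_real cr)
  \<comment> \<open>Reflection in the origin followed by a shift is the reflection in
    \<open>m\<close>.\<close>
  have "integral {m..b} h = integral {-b..-m} (\<lambda>x. h (- x))" by simp
  also have "\<dots> = integral {-b - -(a + b)..-m - -(a + b)} (\<lambda>x. h (- (x + -(a + b))))"
    by (rule integral_shift_real_ivl[symmetric])
  also have "\<dots> = integral {a..m} (\<lambda>x. h (a + b - x))"
    by (simp add: m_def field_simps)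
  finally have refl: "integral {m..b} h = integral {a..m} (\<lambda>x. h (a + b - x))" .
  have "integral {a..b} h = integral {a..m} h + integral {m..b} h"
    using h m by (intro Henstock_Kurzweil_Integration.integral_combine[symmetric]
        integrable_continuous_real) auto
  then have eq: "(b - a) / 2 * (h a + h b) - integral {a..b} h
      = integral {a..m} (\<lambda>x. h a + h b - h x - h (a + b - x))"
    using hl hr m(1) unfolding refl
    by (simp add: integral_diff integrable_diff integrable_const_ivl) (simp add: m_def field_simps)
  have "((\<lambda>x. K * (x - a)) has_integral K * (m - a)\<^sup>2 / 2 - K * (a - a)\<^sup>2 / 2) {a..m}"
    by (rule fundamental_theorem_of_calculus[OF m(1)])
      (auto simp: has_real_derivative_iff_has_vector_derivative[symmetric] field_simps
        intro!: derivative_eq_intros)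
  then have K: "((\<lambda>x. K * (x - a)) has_integral K * (b - a)\<^sup>2 / 8) {a..m}"
    by (simp add: m_def field_simps power2_eq_square)
  have "norm (integral {a..m} (\<lambda>x. h a + h b - h x - h (a + b - x)))
      \<le> integral {a..m} (\<lambda>x. K * (x - a))"
    by (rule integral_norm_bound_integral)
      (use K le hl hr in \<open>auto simp: m_def intro!: integrable_diff integrable_const_ivl\<close>)
  then show ?thesis unfolding integral_unique[OF K] eq real_norm_def .
qed

section \<open>A bilinear majorant from co-ordinated convexity\<close>

text \<open>The concave function \<open>z powr (1 / q)\<close> lies below its tangent at
  \<open>S\<close>. This is Young's inequality with weights \<open>1 / q\<close> and
  \<open>1 - 1 / q\<close>, divided by \<open>S powr (1 - 1 / q)\<close>.\<close>

lemma powr_inverse_le_tangent: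
  fixes z S q :: real
  assumes "q \<ge> 1" "z \<ge> 0" "S > 0"
  shows "z powr (1 / q) \<le> S powr (1 / q) + S powr (1 / q - 1) / q * (z - S)"
proof -
  have S: "S powr (1 / q) = S powr (1 / q - 1) * S"
    using assms(3) by (simp add: powr_diff)
  have "z powr (1 / q) * S powr (1 - 1 / q) \<le> 1 / q * z + (1 - 1 / q) * S"
  proof (cases "z = 0")
    case False
    then show ?thesis using assms by (intro Youngs_inequality_0) auto
  qed (use assms in auto)
  then have "z powr (1 / q) * S powr (1 - 1 / q) * S powr (1 / q - 1)
      \<le> (1 / q * z + (1 - 1 / q) * S) * S powr (1 / q - 1)"
    by (rule mult_right_mono) simp
  moreover have "S powr (1 - 1 / q) * S powr (1 / q - 1) = 1"
    using assms(3) by (simp add: powr_add[symmetric])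
  ultimately have "z powr (1 / q) \<le> (1 / q * z + (1 - 1 / q) * S) * S powr (1 / q - 1)"
    by (simp add: mult.assoc)
  then show ?thesis unfolding S by (simp add: algebra_simps diff_divide_distrib)
qed

text \<open>Convexity at the corners puts \<open>\<bar>G\<bar> powr q\<close> below the bilinear
  interpolant \<open>B\<close> of its corner values, and the tangent at \<open>S\<close> keeps the
  bound bilinear. \<open>S\<close> is the value of \<open>B\<close> at the centre, hence the
  constant term in centred coordinates. The other coefficients will cancel, so their existence
  suffices.\<close>

lemma coordinated_convex_powr_bilinear_bound:
  fixes G :: "real \<times> real \<Rightarrow> real"
  assumes ab: "a < b" "c < d" and q: "q \<ge> 1"
    and conv: "coordinated_convex_on_rect a b c d (\<lambda>p. \<bar>G p\<bar> powr q)"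
  defines "S \<equiv> (\<bar>G (a, c)\<bar> powr q + \<bar>G (a, d)\<bar> powr q
      + \<bar>G (b, c)\<bar> powr q + \<bar>G (b, d)\<bar> powr q) / 4"
  obtains k1 k2 k3 where "\<And>x y. x \<in> {a..b} \<Longrightarrow> y \<in> {c..d} \<Longrightarrow>
    \<bar>G (x, y)\<bar> \<le> S powr (1 / q) + k1 * (x - (a + b) / 2) + k2 * (y - (c + d) / 2)
      + k3 * (x - (a + b) / 2) * (y - (c + d) / 2)"
proof -
  define g where "g = (\<lambda>p. \<bar>G p\<bar> powr q)"
  define t where "t x = (b - x) / (b - a)" for x
  define s where "s y = (d - y) / (d - c)" for y
  define B where "B x y = t x * s y * g (a, c) + s y * (1 - t x) * g (b, c)
    + t x * (1 - s y) * g (a, d) + (1 - t x) * (1 - s y) * g (b, d)" for x y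
  have S: "S = (g (a, c) + g (a, d) + g (b, c) + g (b, d)) / 4" by (simp add: S_def g_def)
  have g0: "g p \<ge> 0" for p by (simp add: g_def)
  have gB: "g (x, y) \<le> B x y" if xy: "x \<in> {a..b}" "y \<in> {c..d}" for x y
  proof -
    have ts: "t x \<in> {0..1}" "s y \<in> {0..1}" using xy ab by (auto simp: t_def s_def field_simps)
    have "t x * (b - a) = b - x" "s y * (d - c) = d - y"
      using ab by (simp_all add: t_def s_def)
    then have "t x * a + (1 - t x) * b = x" "s y * c + (1 - s y) * d = y"
      by (simp_all add: algebra_simps)
    moreover have "g (t x * a + (1 - t x) * b, s y * c + (1 - s y) * d) \<le> B x y"
      using conv ts ab unfolding coordinated_convex_on_rect_def g_def B_def by simp
    ultimately show ?thesis by simp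
  qed
  have GB: "\<bar>G (x, y)\<bar> \<le> B x y powr (1 / q)" if "x \<in> {a..b}" "y \<in> {c..d}" for x y
  proof -
    have "\<bar>G (x, y)\<bar> = g (x, y) powr (1 / q)" using q by (simp add: g_def powr_powr)
    also have "\<dots> \<le> B x y powr (1 / q)" using gB[OF that] g0 q by (intro powr_mono2) auto
    finally show ?thesis .
  qed
  define r where "r = S powr (1 / q - 1) / q"
  have tangent: "B x y powr (1 / q) \<le> S powr (1 / q) + r * (B x y - S)"
    if xy: "x \<in> {a..b}" "y \<in> {c..d}" for x y
  \<comment> \<open>The tangent needs \<open>S > 0\<close>. If \<open>S = 0\<close>, the nonnegative
    corner values all vanish, and with them both sides.\<close>
  proof (cases "S = 0")
    case True
    then have "g (a, c) = 0" "g (a, d) = 0" "g (b, c) = 0" "g (b, d) = 0"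
      using S g0[of "(a, c)"] g0[of "(a, d)"] g0[of "(b, c)"] g0[of "(b, d)"] by simp_all
    then show ?thesis using True by (simp add: B_def)
  next
    case False
    moreover have "S \<ge> 0" unfolding S using g0 by simp
    ultimately have "S > 0" by simp
    moreover have "B x y \<ge> 0" using gB[OF xy] g0[of "(x, y)"] by linarith
    ultimately show ?thesis using powr_inverse_le_tangent[OF q] unfolding r_def by blast
  qed
  \<comment> \<open>The coefficients of \<open>B\<close> about the centre: the mean slopes in each
    variable and the mixed difference quotient.\<close>
  define k1 where "k1 = (g (b, c) + g (b, d) - g (a, c) - g (a, d)) / 2 / (b - a)"
  define k2 where "k2 = (g (a, d) + g (b, d) - g (a, c) - g (b, c)) / 2 / (d - c)"
  define k3 where "k3 = (g (a, c) + g (b, d) - g (a, d) - g (b, c)) / ((b - a) * (d - c))"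
  have BS: "B x y - S = k1 * (x - (a + b) / 2) + k2 * (y - (c + d) / 2)
      + k3 * (x - (a + b) / 2) * (y - (c + d) / 2)" for x y
  proof -
    \<comment> \<open>In centred coordinates scaled by the side lengths the weights are
      \<open>1 / 2 - X\<close> and \<open>1 / 2 - Y\<close>, and the claim is a polynomial
      identity.\<close>
    define X where "X = (x - (a + b) / 2) / (b - a)"
    define Y where "Y = (y - (c + d) / 2) / (d - c)"
    have t: "t x = 1 / 2 - X" and s: "s y = 1 / 2 - Y"
      using ab by (simp_all add: t_def s_def X_def Y_def field_simps)
    have x: "x - (a + b) / 2 = X * (b - a)" and y: "y - (c + d) / 2 = Y * (d - c)"
      using ab by (simp_all add: X_def Y_def)
    have cancel: "z / w * w = z" if "w \<noteq> 0" for z w :: real using that by simp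
    have k: "k1 * (b - a) = (g (b, c) + g (b, d) - g (a, c) - g (a, d)) / 2"
      "k2 * (d - c) = (g (a, d) + g (b, d) - g (a, c) - g (b, c)) / 2"
      "k3 * ((b - a) * (d - c)) = g (a, c) + g (b, d) - g (a, d) - g (b, c)"
      unfolding k1_def k2_def k3_def
      by (rule cancel; use ab in simp)+
    have "k1 * (x - (a + b) / 2) + k2 * (y - (c + d) / 2)
        + k3 * (x - (a + b) / 2) * (y - (c + d) / 2)
      = k1 * (b - a) * X + k2 * (d - c) * Y + k3 * ((b - a) * (d - c)) * (X * Y)"
      unfolding x y by (simp add: algebra_simps)
    also have "\<dots> = B x y - S"
      unfolding k B_def S t s by (simp add: field_simps)
    finally show ?thesis by simp
  qed
  show thesis
  proof (rule that[of "r * k1" "r * k2" "r * k3"])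
    fix x y assume xy: "x \<in> {a..b}" "y \<in> {c..d}"
    have "\<bar>G (x, y)\<bar> \<le> S powr (1 / q) + r * (B x y - S)"
      using GB[OF xy] tangent[OF xy] by simp
    then show "\<bar>G (x, y)\<bar> \<le> S powr (1 / q) + r * k1 * (x - (a + b) / 2)
        + r * k2 * (y - (c + d) / 2) + r * k3 * (x - (a + b) / 2) * (y - (c + d) / 2)"
      unfolding BS distrib_left by (simp only: mult.assoc add.assoc)
  qed
qed

section \<open>Folding in both variables\<close>

text \<open>The left side is the defect folded in both variables. The triangle inequality replaces
  it by the sum of the increments of \<open>P\<close> over four rectangles symmetric about the
  centre. There the terms of \<open>\<psi>\<close> odd in a centred variable cancel, and
  \<open>k0\<close> times the four areas remains.\<close>

lemma folded_increment_le:
  assumes f: "partial_differentiable_on_rect a b c d f"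
    and le: "\<And>x y. x \<in> {a..b} \<Longrightarrow> y \<in> {c..d} \<Longrightarrow> \<bar>mixed_partial a b c d f (x, y)\<bar>
      \<le> k0 + k1 * (x - (a + b) / 2) + k2 * (y - (c + d) / 2)
        + k3 * (x - (a + b) / 2) * (y - (c + d) / 2)"
    and x: "a \<le> x" "x \<le> (a + b) / 2" and y: "c \<le> y" "y \<le> (c + d) / 2"
  shows "\<bar>rect_increment f (a + b - x) b (c + d - y) d - rect_increment f a x (c + d - y) d
      - rect_increment f (a + b - x) b c y + rect_increment f a x c y\<bar>
    \<le> 4 * k0 * (x - a) * (y - c)"
proof -
  define m n where "m = (a + b) / 2" and "n = (c + d) / 2"
  \<comment> \<open>\<open>Q\<close> and \<open>P\<close> integrate \<open>\<psi>\<close> from the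
    centre, in the first variable and then in the second.\<close>
  define P :: "real \<times> real \<Rightarrow> real" where "P = (\<lambda>(x, y). k0 * (x - m) * (y - n)
    + k1 * (x - m)\<^sup>2 / 2 * (y - n) + k2 * (x - m) * (y - n)\<^sup>2 / 2
    + k3 * (x - m)\<^sup>2 * (y - n)\<^sup>2 / 4)"
  define Q :: "real \<times> real \<Rightarrow> real" where "Q = (\<lambda>(x, y). k0 * (x - m)
    + k1 * (x - m)\<^sup>2 / 2 + k2 * (x - m) * (y - n) + k3 * (x - m)\<^sup>2 * (y - n) / 2)"
  define \<psi> :: "real \<times> real \<Rightarrow> real" where "\<psi> = (\<lambda>(x, y). k0
    + k1 * (x - m) + k2 * (y - n) + k3 * (x - m) * (y - n))"
  have P: "((\<lambda>s. P (x, s)) has_vector_derivative Q (x, y)) (at y within {c..d})" for x y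
    unfolding has_real_derivative_iff_has_vector_derivative[symmetric] P_def Q_def prod.case
    by (auto intro!: derivative_eq_intros simp: field_simps)
  have Q: "((\<lambda>t. Q (t, y)) has_vector_derivative \<psi> (x, y)) (at x within {a..b})" for x y
    unfolding has_real_derivative_iff_has_vector_derivative[symmetric] \<psi>_def Q_def prod.case
    by (auto intro!: derivative_eq_intros simp: field_simps)
  have \<psi>: "\<bar>mixed_partial a b c d f (x, y)\<bar> \<le> \<psi> (x, y)" if "x \<in> {a..b}" "y \<in> {c..d}" for x y
    using le[OF that] by (simp add: \<psi>_def m_def n_def)
  note inc = rect_increment_le[OF f P Q \<psi>]
  have xy: "x \<le> a + b - x" "y \<le> c + d - y" using x y by auto
  have "\<bar>rect_increment f (a + b - x) b (c + d - y) d\<bar> \<le> rect_increment P (a + b - x) b (c + d - y) d"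
    "\<bar>rect_increment f a x (c + d - y) d\<bar> \<le> rect_increment P a x (c + d - y) d"
    "\<bar>rect_increment f (a + b - x) b c y\<bar> \<le> rect_increment P (a + b - x) b c y"
    "\<bar>rect_increment f a x c y\<bar> \<le> rect_increment P a x c y"
    by (rule inc; use x y xy in linarith)+
  moreover have "rect_increment P (a + b - x) b (c + d - y) d + rect_increment P a x (c + d - y) d
      + rect_increment P (a + b - x) b c y + rect_increment P a x c y = 4 * k0 * (x - a) * (y - c)"
  proof -
    \<comment> \<open>Relative to the centre, the reflections become sign changes.\<close>
    define X Y u v where "X = x - m" and "Y = y - n" and "u = b - m" and "v = d - n"
    have e: "a - m = - u" "b - m = u" "x - m = X" "a + b - x - m = - X"
      "c - n = - v" "d - n = v" "y - n = Y" "c + d - y - n = - Y"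
      "x - a = X + u" "y - c = Y + v"
      by (auto simp: X_def Y_def u_def v_def m_def n_def field_simps)
    show ?thesis
      unfolding rect_increment_def P_def prod.case e by (simp add: algebra_simps)
  qed
  ultimately show ?thesis by linarith
qed

section \<open>The trapezoid estimate in two variables\<close>

theorem theorem4:
  fixes a b c d q :: real and f :: "real \<times> real \<Rightarrow> real"
  assumes "a < b" and "c < d" and "q \<ge> 1"
    and "partial_differentiable_on_rect a b c d f"
    and "coordinated_convex_on_rect a b c d (\<lambda>p. \<bar>mixed_partial a b c d f p\<bar> powr q)"
  defines "A \<equiv> 1 / 2 *
      (1 / (b - a) * integral {a..b} (\<lambda>x. f (x, c) + f (x, d))
        + 1 / (d - c) * integral {c..d} (\<lambda>y. f (a, y) + f (b, y)))"
  shows "\<bar>(f (a, c) + f (a, d) + f (b, c) + f (b, d)) / 4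
      + 1 / ((b - a) * (d - c)) * integral {a..b} (\<lambda>x. integral {c..d} (\<lambda>y. f (x, y)))
      - A\<bar>
    \<le> (b - a) * (d - c) / 16 *
      ((\<bar>mixed_partial a b c d f (a, c)\<bar> powr q + \<bar>mixed_partial a b c d f (a, d)\<bar> powr q
        + \<bar>mixed_partial a b c d f (b, c)\<bar> powr q + \<bar>mixed_partial a b c d f (b, d)\<bar> powr q) / 4)
        powr (1 / q)"
proof -
  define S where "S = (\<bar>mixed_partial a b c d f (a, c)\<bar> powr q
    + \<bar>mixed_partial a b c d f (a, d)\<bar> powr q + \<bar>mixed_partial a b c d f (b, c)\<bar> powr q
    + \<bar>mixed_partial a b c d f (b, d)\<bar> powr q) / 4"
  define k0 where "k0 = S powr (1 / q)"
  obtain k1 k2 k3 where le: "\<bar>mixed_partial a b c d f (x, y)\<bar>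
      \<le> k0 + k1 * (x - (a + b) / 2) + k2 * (y - (c + d) / 2)
        + k3 * (x - (a + b) / 2) * (y - (c + d) / 2)"
    if "x \<in> {a..b}" "y \<in> {c..d}" for x y
    using coordinated_convex_powr_bilinear_bound[OF assms(1,2,3,5)] unfolding k0_def S_def by blast
  \<comment> \<open>The majorant is continuous on a compact rectangle, which yields the constant
    bound \<open>M\<close> behind joint continuity.\<close>
  define \<psi> where "\<psi> = (\<lambda>p. k0 + k1 * (fst p - (a + b) / 2) + k2 * (snd p - (c + d) / 2)
        + k3 * (fst p - (a + b) / 2) * (snd p - (c + d) / 2))"
  have "bounded (\<psi> ` ({a..b} \<times> {c..d}))"
    unfolding \<psi>_def
    by (intro compact_imp_bounded compact_continuous_image continuous_intros
        compact_Times) auto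
  then obtain M where "\<And>p. p \<in> {a..b} \<times> {c..d} \<Longrightarrow> \<bar>\<psi> p\<bar> \<le> M"
    unfolding bounded_iff by auto
  then have M: "\<bar>mixed_partial a b c d f (x, y)\<bar> \<le> M" if "x \<in> {a..b}" "y \<in> {c..d}" for x y
    using le[OF that] that by (fastforce simp: \<psi>_def)
  have cont: "continuous_on ({a..b} \<times> {c..d}) f"
    by (rule continuous_on_rect[OF assms(4) M])
  have cx: "continuous_on {a..b} (\<lambda>x. f (x, y))" if "y \<in> {c..d}" for y
    by (rule continuous_on_compose2[OF cont]) (use that in \<open>auto intro!: continuous_intros\<close>)
  have cy: "continuous_on {c..d} (\<lambda>y. f (x, y))" if "x \<in> {a..b}" for x
    by (rule continuous_on_compose2[OF cont]) (use that in \<open>auto intro!: continuous_intros\<close>)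
  have iy: "(\<lambda>y. f (x, y)) integrable_on {c..d}" if "x \<in> {a..b}" for x
    by (intro integrable_continuous_real cy that)
  define J where "J x = integral {c..d} (\<lambda>y. f (x, y))" for x
  have cJ: "continuous_on {a..b} J"
    using integral_continuous_on_param[of "{a..b}" c d "\<lambda>x y. f (x, y)"] cont
    by (simp add: J_def[abs_def])
  \<comment> \<open>\<open>k x\<close> is the trapezoid error of the section at \<open>x\<close>;
    the trapezoid error of \<open>k\<close> will be the left-hand side times the area.\<close>
  define k where "k x = (d - c) / 2 * (f (x, c) + f (x, d)) - J x" for x
  have ck: "continuous_on {a..b} k"
    unfolding k_def using assms(2) by (intro continuous_intros cJ cx) auto
  have "\<bar>k a + k b - k x - k (a + b - x)\<bar> \<le> (k0 * (d - c)\<^sup>2 / 2) * (x - a)"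
    if x: "a \<le> x" "x \<le> (a + b) / 2" for x
  proof -
    have mem: "a \<in> {a..b}" "b \<in> {a..b}" "x \<in> {a..b}" "a + b - x \<in> {a..b}"
      using x assms(1) by auto
    \<comment> \<open>By linearity, folding \<open>k\<close> in the first variable gives the
      trapezoid error of the folded section \<open>h\<close>.\<close>
    define h where "h y = f (a, y) + f (b, y) - f (x, y) - f (a + b - x, y)" for y
    have "\<bar>(d - c) / 2 * (h c + h d) - integral {c..d} h\<bar> \<le> (4 * k0 * (x - a)) * (d - c)\<^sup>2 / 8"
    proof (rule trapezoid_error_le)
      show "continuous_on {c..d} h" unfolding h_def by (intro continuous_intros cy mem)
      show "\<bar>h c + h d - h y - h (c + d - y)\<bar> \<le> 4 * k0 * (x - a) * (y - c)"
        if "c \<le> y" "y \<le> (c + d) / 2" for y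
        using folded_increment_le[OF assms(4) le x that]
        by (simp add: h_def rect_increment_def algebra_simps)
    qed (use assms(2) in simp)
    moreover have "integral {c..d} h = J a + J b - J x - J (a + b - x)"
      unfolding h_def J_def using iy[OF mem(1)] iy[OF mem(2)] iy[OF mem(3)] iy[OF mem(4)]
      by (simp add: integral_diff integral_add integrable_diff integrable_add)
    ultimately show ?thesis by (simp add: k_def h_def algebra_simps)
  qed
  \<comment> \<open>The factors \<open>4 / 8\<close> and \<open>1 / 8\<close> from the two variables
    combine to the constant \<open>1 / 16\<close>.\<close>
  then have bound: "\<bar>(b - a) / 2 * (k a + k b) - integral {a..b} k\<bar>
      \<le> (k0 * (d - c)\<^sup>2 / 2) * (b - a)\<^sup>2 / 8"
    using assms(1) by (intro trapezoid_error_le ck) auto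
  have sum_x: "(\<lambda>x. f (x, c) + f (x, d)) integrable_on {a..b}"
    using assms(2) by (intro integrable_continuous_real continuous_intros cx) auto
  have int_k: "integral {a..b} k
      = (d - c) / 2 * integral {a..b} (\<lambda>x. f (x, c) + f (x, d)) - integral {a..b} J"
    unfolding k_def using integrable_continuous_real[OF cJ] integrable_on_cmult_left[OF sum_x]
    by (subst integral_diff) (auto simp: integral_mult_right)
  have int_y: "integral {c..d} (\<lambda>y. f (a, y) + f (b, y)) = J a + J b"
    unfolding J_def using assms(1) by (intro integral_add iy) auto
  let ?L = "(f (a, c) + f (a, d) + f (b, c) + f (b, d)) / 4
      + 1 / ((b - a) * (d - c)) * integral {a..b} J - A"
  have pos: "(b - a) * (d - c) > 0" using assms(1,2) by simp
  have scaled: "?L * ((b - a) * (d - c)) = (b - a) / 2 * (k a + k b) - integral {a..b} k"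
  proof -
    define I u v where "I = integral {a..b} (\<lambda>x. f (x, c) + f (x, d))"
      and "u = b - a" and "v = d - c"
    have uv: "u > 0" "v > 0" using assms(1,2) by (simp_all add: u_def v_def)
    show ?thesis
      unfolding A_def int_y int_k k_def I_def[symmetric] u_def[symmetric] v_def[symmetric]
      using uv by (simp add: field_simps)
  qed
  have "\<bar>?L\<bar> * ((b - a) * (d - c)) = \<bar>?L * ((b - a) * (d - c))\<bar>"
    by (subst abs_mult) (simp only: abs_of_pos[OF pos])
  also have "\<dots> \<le> ((b - a) * (d - c) / 16 * k0) * ((b - a) * (d - c))"
    using bound unfolding scaled by (simp add: power2_eq_square algebra_simps)
  finally have "\<bar>?L\<bar> \<le> (b - a) * (d - c) / 16 * k0"
    using pos by (simp only: mult_le_cancel_right_pos)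
  then show ?thesis unfolding k0_def S_def J_def .
qed

end
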